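(* Let $\mathcal{G}=(\mathcal{V},\mathcal{E})$ be a social trust network with internal opinion vector $\mathbf{s}$, and let $\mathcal{U}^{t-1}$ be the set of nodes chosen in the first $t-1$ iterations of the greedy algorithm described in the context. Let $\mathbf{Q}^{\mathcal{U}^{t-1}}=(q^{\mathcal{U}^{t-1}}_{jk})$ be the fundamental matrix after fixing the expressed opinions of the nodes in $\mathcal{U}^{t-1}$, and put $\mathbf{g}^{\mathcal{U}^{t-1}}=(\vec{\mathbf{1}}^T\mathbf{Q}^{\mathcal{U}^{t-1}})^T$ and $\mathbf{z}^{\mathcal{U}^{t-1}*}=\mathbf{Q}^{\mathcal{U}^{t-1}}\mathbf{s}$. Then, for $i\in\mathcal{V}\setminus\mathcal{U}^{t-1}$, the benefit of fixing the expressed opinion of $i$ in the $t$-th iteration is $$\vec{\mathbf{1}}^T\left(\mathbf{Q}^{\mathcal{U}^{t-1}\cup\{i\}}-\mathbf{Q}^{\mathcal{U}^{t-1}}\right)\mathbf{s}=\frac{g^{\mathcal{U}^{t-1}}_i}{q^{\mathcal{U}^{t-1}}_{ii}}\,\bigl(s_i-z^{\mathcal{U}^{t-1}*}_i\bigr).$$ That is, it is the $i$-th component of $$\mathbf{b}=\operatorname{diag}(\mathbf{g}^{\mathcal{U}^{t-1}})\,\bigl(\operatorname{diag}(\mathbf{Q}^{\mathcal{U}^{t-1}})\bigr)^{-1}\bigl(\mathbf{s}-\mathbf{z}^{\mathcal{U}^{t-1}*}\bigr),$$ where $\operatorname{diag}$ of a vector is the diagonal matrix with that vector on its diagonal, and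 $\operatorname{diag}$ of a matrix is the diagonal matrix keeping only the diagonal entries of that matrix.
   Context: A social trust network is a directed signed weighted graph $\mathcal{G}=(\mathcal{V},\mathcal{E})$ with weights $w_{ij}\in[-1,1]$ on edges $(i,j)\in\mathcal{E}$. The adjacency matrix $\mathbf{A}=(a_{ij})$ has $a_{ij}=w_{ij}$ if $(i,j)\in\mathcal{E}$ and $a_{ij}=0$ otherwise. $\mathbf{D}$ is the diagonal matrix with $d_{ii}=\sum_j|a_{ij}|$, $\bar{\mathbf{L}}=\mathbf{D}-\mathbf{A}$, and the fundamental matrix is $\mathbf{Q}=(\bar{\mathbf{L}}+\mathbf{I})^{-1}$, with $\mathbf{I}$ the identity matrix. $\vec{\mathbf{1}}$ is the all-ones column vector. Each node $i$ has an internal opinion $s_i\in[-1,1]$, the $i$-th component of $\mathbf{s}$. Fixing the expressed opinion of node $i$ to its internal opinion $s_i$ amounts to replacing the $i$-th row of $\mathbf{A}$ by a row of zeros, with $\mathbf{D}$ changed accordingly. For a set $\mathcal{U}$ of nodes, $\mathbf{Q}^{\mathcal{U}}$ denotes the fundamental matrix after fixing the expressed opinions of the nodes in $\mathcal{U}$, that is, $\mathbf{Q}^{\mathcal{U}}=(\mathbf{D}^{\mathcal{U}}-\mathbf{A}^{\mathcal{U}}+\mathbf{I})^{-1}$, where $\mathbf{A}^{\mathcal{U}}$ is $\mathbf{A}$ with the rows indexed by $\mathcal{U}$ replaced by zero rows and $\mathbf{D}^{\mathcal{U}}$ is the diagonal matrix of the row sums of absolute values of $\mathbf{A}^{\mathcal{U}}$.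 The vector $\mathbf{Q}^{\mathcal{U}}\mathbf{s}$ is the equilibrium expressed opinion vector after this fixing, and $\vec{\mathbf{1}}^T\mathbf{Q}^{\mathcal{U}}\mathbf{s}$ is the corresponding overall opinion. Greedy algorithm: start with the empty set $\mathcal{U}^0$. In the $t$-th iteration, obtain $\mathcal{U}^{t}$ from $\mathcal{U}^{t-1}$ by adding a node $i\in\mathcal{V}\setminus\mathcal{U}^{t-1}$ for which the benefit to the overall opinion, $\vec{\mathbf{1}}^T(\mathbf{Q}^{\mathcal{U}^{t-1}\cup\{i\}}-\mathbf{Q}^{\mathcal{U}^{t-1}})\mathbf{s}$, is maximized. *)

theory Defs
  imports "HOL-Analysis.Analysis"
begin

(* The node set is the (finite) universe of the index type 'n. The values of the weight
   function w outside the edge set E are irrelevant. *)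

definition social_trust_network :: "('n::finite \<times> 'n) set \<Rightarrow> ('n \<Rightarrow> 'n \<Rightarrow> real) \<Rightarrow> bool" where
  "social_trust_network E w \<longleftrightarrow> (\<forall>(i, j) \<in> E. w i j \<in> {-1..1})"

definition internal_opinions :: "real ^ 'n \<Rightarrow> bool" where
  "internal_opinions s \<longleftrightarrow> (\<forall>i. s $ i \<in> {-1..1})"

definition adjacency_matrix :: "('n::finite \<times> 'n) set \<Rightarrow> ('n \<Rightarrow> 'n \<Rightarrow> real) \<Rightarrow> real ^ 'n ^ 'n" where
  "adjacency_matrix E w = (\<chi> i j. if (i, j) \<in> E then w i j else 0)"

definition diag_of_vec :: "real ^ 'n \<Rightarrow> real ^ 'n ^ 'n" where
  "diag_of_vec v = (\<chi> i j. if i = j then v $ i else 0)"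

definition diag_of_mat :: "real ^ 'n ^ 'n \<Rightarrow> real ^ 'n ^ 'n" where
  "diag_of_mat M = (\<chi> i j. if i = j then M $ i $ j else 0)"

definition degree_matrix :: "real ^ 'n ^ 'n \<Rightarrow> real ^ 'n ^ 'n" where
  "degree_matrix A = diag_of_vec (\<chi> i. \<Sum>j\<in>UNIV. \<bar>A $ i $ j\<bar>)"

definition laplacian :: "real ^ 'n ^ 'n \<Rightarrow> real ^ 'n ^ 'n" where
  "laplacian A = degree_matrix A - A"

(* The matrix inverted here is strictly diagonally dominant, so the inverse exists. *)
definition fundamental_matrix :: "real ^ 'n ^ 'n \<Rightarrow> real ^ 'n ^ 'n" where
  "fundamental_matrix A = matrix_inv (laplacian A + mat 1)"

definition zero_rows :: "'n set \<Rightarrow> real ^ 'n ^ 'n \<Rightarrow> real ^ 'n ^ 'n" where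
  "zero_rows U A = (\<chi> i j. if i \<in> U then 0 else A $ i $ j)"

definition fixed_fundamental_matrix ::
    "('n::finite \<times> 'n) set \<Rightarrow> ('n \<Rightarrow> 'n \<Rightarrow> real) \<Rightarrow> 'n set \<Rightarrow> real ^ 'n ^ 'n" where
  "fixed_fundamental_matrix E w U = fundamental_matrix (zero_rows U (adjacency_matrix E w))"

(* The constant 1 of type real ^ 'n is the all-ones vector. *)
definition benefit ::
    "('n::finite \<times> 'n) set \<Rightarrow> ('n \<Rightarrow> 'n \<Rightarrow> real) \<Rightarrow> real ^ 'n \<Rightarrow> 'n set \<Rightarrow> 'n \<Rightarrow> real" where
  "benefit E w s U i =
     1 \<bullet> ((fixed_fundamental_matrix E w (U \<union> {i}) - fixed_fundamental_matrix E w U) *v s)"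

(* greedy_chosen E w s t U: U is a possible result of the first t greedy iterations;
   ties between maximizers may be broken in any way. *)
inductive greedy_chosen ::
    "('n::finite \<times> 'n) set \<Rightarrow> ('n \<Rightarrow> 'n \<Rightarrow> real) \<Rightarrow> real ^ 'n \<Rightarrow> nat \<Rightarrow> 'n set \<Rightarrow> bool"
  for E w s where
  start: "greedy_chosen E w s 0 {}"
| step: "greedy_chosen E w s t U \<Longrightarrow> i \<in> UNIV - U \<Longrightarrow>
    (\<forall>j \<in> UNIV - U. benefit E w s U j \<le> benefit E w s U i) \<Longrightarrow>
    greedy_chosen E w s (Suc t) (U \<union> {i})"

end

theory Submission
  imports Defs
begin

text \<open>Let \<open>A\<close> be the adjacency matrix with the rows in \<open>U\<close> already
  zeroed, M = \<open>laplacian A + mat 1\<close>, Q its inverse and z = Q s. Strict diagonal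
  dominance makes M invertible (\<open>laplacian_add_mat_1_kernel\<close>). Fixing node i turns row
  i of M into the unit row and keeps the others (\<open>laplacian_zero_rows_mult_nth\<close>), so
  the new equilibrium y solves M y = s + c e_i with y_i = s_i. Hence y = z + c Q e_i with c = (s_i -
  z_i) / q_ii (\<open>fundamental_matrix_zero_row_mult\<close>), and summing entries gives c g_i, as
  column i of Q sums to g_i.\<close>

lemma
  fixes M :: "'a::semiring_1 ^ 'n ^ 'm"
  assumes "invertible M"
  shows matrix_inv_right: "M ** matrix_inv M = mat 1"
    and matrix_inv_left: "matrix_inv M ** M = mat 1"
  using someI_ex[OF assms[unfolded invertible_def]] by (simp_all add: matrix_inv_def)

lemma matrix_inv_unique:
  fixes M :: "'a::semiring_1 ^ 'n ^ 'm"
  assumes "M ** N = mat 1" "N ** M = mat 1"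
  shows "matrix_inv M = N"
proof -
  have "matrix_inv M ** M = mat 1"
    using assms by (intro matrix_inv_left) (auto simp: invertible_def)
  then show ?thesis
    using assms(1) by (metis matrix_mul_assoc matrix_mul_lid matrix_mul_rid)
qed

text \<open>Row j depends on row j of \<open>A\<close> alone: both diagonal dominance and the effect
  of zeroing rows are read off from this form.\<close>

lemma laplacian_add_mat_1_mult_nth:
  fixes A :: "real ^ 'n ^ 'n"
  shows "((laplacian A + mat 1) *v x) $ j =
    (1 + (\<Sum>k\<in>UNIV. \<bar>A $ j $ k\<bar>)) * x $ j - (\<Sum>k\<in>UNIV. A $ j $ k * x $ k)"
proof -
  have "(degree_matrix A *v x) $ j = (\<Sum>k\<in>UNIV. \<bar>A $ j $ k\<bar>) * x $ j"
    by (simp add: degree_matrix_def diag_of_vec_def matrix_vector_mult_def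
        if_distrib[of "\<lambda>a. a * _"] cong: if_cong)
  moreover have "(laplacian A + mat 1) *v x = degree_matrix A *v x - A *v x + x"
    by (simp add: laplacian_def matrix_vector_mult_add_rdistrib matrix_vector_mult_diff_rdistrib)
  moreover have "(A *v x) $ j = (\<Sum>k\<in>UNIV. A $ j $ k * x $ k)"
    by (simp add: matrix_vector_mult_def)
  ultimately show ?thesis
    by (simp add: distrib_right)
qed

text \<open>Strict diagonal dominance, read at a coordinate of maximal modulus.\<close>

lemma laplacian_add_mat_1_kernel:
  fixes A :: "real ^ 'n ^ 'n"
  assumes "(laplacian A + mat 1) *v x = 0"
  shows "x = 0"
proof -
  have "finite (range (\<lambda>k. \<bar>x $ k\<bar>))" "range (\<lambda>k. \<bar>x $ k\<bar>) \<noteq> {}"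
    by auto
  then obtain j where "\<bar>x $ j\<bar> = Max (range (\<lambda>k. \<bar>x $ k\<bar>))"
    using Max_in by (metis (no_types, lifting) imageE)
  then have max: "\<bar>x $ k\<bar> \<le> \<bar>x $ j\<bar>" for k
    by simp
  let ?d = "\<Sum>k\<in>UNIV. \<bar>A $ j $ k\<bar>"
  have "?d \<ge> 0"
    by (simp add: sum_nonneg)
  have "(1 + ?d) * x $ j = (\<Sum>k\<in>UNIV. A $ j $ k * x $ k)"
    using laplacian_add_mat_1_mult_nth[of A x j] assms by simp
  then have "(1 + ?d) * \<bar>x $ j\<bar> = \<bar>\<Sum>k\<in>UNIV. A $ j $ k * x $ k\<bar>"
    using \<open>?d \<ge> 0\<close> by (metis abs_mult abs_of_nonneg add_nonneg_nonneg zero_le_one)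
  also have "\<dots> \<le> (\<Sum>k\<in>UNIV. \<bar>A $ j $ k\<bar> * \<bar>x $ k\<bar>)"
    by (metis (no_types, lifting) abs_mult sum.cong sum_abs)
  also have "\<dots> \<le> ?d * \<bar>x $ j\<bar>"
    by (auto simp: sum_distrib_right intro!: sum_mono mult_left_mono max)
  finally have "\<bar>x $ j\<bar> \<le> 0"
    by (simp add: algebra_simps)
  with max have "x $ k = 0" for k
    by (metis abs_le_zero_iff order_trans)
  then show ?thesis
    by (simp add: vec_eq_iff)
qed

lemma invertible_laplacian_add_mat_1: "invertible (laplacian A + mat 1)"
  for A :: "real ^ 'n ^ 'n"
  using laplacian_add_mat_1_kernel
  by (metis invertible_left_inverse matrix_left_invertible_ker)

lemma laplacian_fundamental_matrix_mult:
  fixes A :: "real ^ 'n ^ 'n"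
  shows "(laplacian A + mat 1) *v (fundamental_matrix A *v x) = x"
  by (simp add: fundamental_matrix_def matrix_vector_mul_assoc
      matrix_inv_right invertible_laplacian_add_mat_1)

text \<open>Lets a candidate equilibrium be verified by substituting it into the linear system,
  without computing the new inverse.\<close>

lemma fundamental_matrix_mult_eqI:
  fixes A :: "real ^ 'n ^ 'n"
  assumes "(laplacian A + mat 1) *v y = x"
  shows "fundamental_matrix A *v x = y"
  by (simp add: fundamental_matrix_def matrix_vector_mul_assoc assms[symmetric]
      matrix_inv_left invertible_laplacian_add_mat_1)

text \<open>A zeroed row also has degree 0, so only the identity remains there; the degrees of other
  rows are row sums and do not change.\<close>

lemma laplacian_zero_rows_mult_nth:
  fixes A :: "real ^ 'n ^ 'n"
  shows "((laplacian (zero_rows U A) + mat 1) *v x) $ j =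
    (if j \<in> U then x $ j else ((laplacian A + mat 1) *v x) $ j)"
  by (simp add: laplacian_add_mat_1_mult_nth zero_rows_def)

lemma fundamental_matrix_mult_axis:
  fixes A :: "real ^ 'n ^ 'n"
  shows "(fundamental_matrix A *v axis i 1) $ j = fundamental_matrix A $ j $ i"
  by (simp add: matrix_vector_mult_basis column_def)

text \<open>If the entry vanished, column i of the inverse would lie in the kernel of the matrix
  with node i fixed: row i reads off that entry, and the other rows give the zeros of
  \<open>axis i 1\<close>. That kernel is trivial.\<close>

lemma fundamental_matrix_diag_nonzero:
  fixes A :: "real ^ 'n ^ 'n"
  shows "fundamental_matrix A $ i $ i \<noteq> 0"
proof
  let ?y = "fundamental_matrix A *v axis i 1"
  assume "fundamental_matrix A $ i $ i = 0"
  then have "?y $ i = 0"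
    by (simp add: fundamental_matrix_mult_axis)
  then have "(laplacian (zero_rows {i} A) + mat 1) *v ?y = 0"
    by (simp add: vec_eq_iff laplacian_zero_rows_mult_nth laplacian_fundamental_matrix_mult axis_def)
  then have "?y = 0"
    by (rule laplacian_add_mat_1_kernel)
  then have "axis i (1 :: real) = 0"
    using laplacian_fundamental_matrix_mult[of A "axis i 1"] by simp
  then show False
    by simp
qed

text \<open>Fixing node \<open>i\<close> leaves a right-hand side that differs from \<open>s\<close> only in the \<open>i\<close>-th
  coordinate, so the new equilibrium is the old one plus a multiple of column \<open>i\<close> of the
  fundamental matrix; the multiple is determined by the \<open>i\<close>-th coordinate being \<open>s $ i\<close>.\<close>

lemma fundamental_matrix_zero_row_mult:
  fixes A :: "real ^ 'n ^ 'n"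
  defines "Q \<equiv> fundamental_matrix A"
  shows "fundamental_matrix (zero_rows {i} A) *v s =
    Q *v s + ((s $ i - (Q *v s) $ i) / Q $ i $ i) *\<^sub>R (Q *v axis i 1)"
    (is "_ = _ + ?c *\<^sub>R _")
proof (rule fundamental_matrix_mult_eqI)
  let ?x = "Q *v s + ?c *\<^sub>R (Q *v axis i 1)"
  have "?x $ i = s $ i"
    using fundamental_matrix_diag_nonzero[of A i]
    by (simp add: Q_def fundamental_matrix_mult_axis)
  moreover have "(laplacian A + mat 1) *v ?x = s + ?c *\<^sub>R axis i 1"
    by (simp add: Q_def matrix_vector_right_distrib matrix_vector_mult_scaleR
        laplacian_fundamental_matrix_mult)
  ultimately show "(laplacian (zero_rows {i} A) + mat 1) *v ?x = s"
    unfolding vec_eq_iff laplacian_zero_rows_mult_nth by (auto simp: axis_def)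
qed

lemma sum_fundamental_matrix_zero_row_diff:
  fixes A :: "real ^ 'n ^ 'n"
  defines "Q \<equiv> fundamental_matrix A"
  shows "1 \<bullet> ((fundamental_matrix (zero_rows {i} A) - Q) *v s) =
    (1 v* Q) $ i / Q $ i $ i * (s $ i - (Q *v s) $ i)"
proof -
  have "1 \<bullet> (Q *v axis i 1) = (1 v* Q) $ i"
    by (simp add: dot_lmul_matrix[symmetric] inner_axis)
  then show ?thesis
    by (simp add: matrix_vector_mult_diff_rdistrib Q_def fundamental_matrix_zero_row_mult)
qed

lemma matrix_inv_diag_of_vec:
  fixes v :: "real ^ 'n"
  assumes "\<And>j. v $ j \<noteq> 0"
  shows "matrix_inv (diag_of_vec v) = diag_of_vec (\<chi> j. inverse (v $ j))"
proof -
  \<comment> \<open>Stated for arbitrary \<open>u\<close> and \<open>v\<close> so that it yields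
    both the left and the right inverse law.\<close>
  have "diag_of_vec u ** diag_of_vec v = mat 1" if "\<And>j. u $ j * v $ j = 1" for u v :: "real ^ 'n"
    by (simp add: diag_of_vec_def matrix_matrix_mult_def mat_def vec_eq_iff that
        if_distrib[of "\<lambda>a. a * _"] cong: if_cong)
  then show ?thesis
    using assms by (intro matrix_inv_unique) simp_all
qed

lemma diag_of_vec_mult_nth: "(diag_of_vec v *v x) $ j = v $ j * x $ j"
  by (simp add: diag_of_vec_def matrix_vector_mult_def if_distrib[of "\<lambda>a. a * _"] cong: if_cong)

lemma diag_of_mat_eq: "diag_of_mat M = diag_of_vec (\<chi> j. M $ j $ j)"
  by (simp add: diag_of_mat_def diag_of_vec_def vec_eq_iff)

theorem mainTheorem6:
  fixes E :: "('n::finite \<times> 'n) set" and w :: "'n \<Rightarrow> 'n \<Rightarrow> real"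
    and s g z b :: "real ^ 'n" and Q :: "real ^ 'n ^ 'n"
    and U :: "'n set" and t :: nat and i :: 'n
  assumes "social_trust_network E w"
    and "internal_opinions s"
    and "t \<ge> 1"
    and "greedy_chosen E w s (t - 1) U"
    and "Q = fixed_fundamental_matrix E w U"
    and "g = 1 v* Q"
    and "z = Q *v s"
    and "b = (diag_of_vec g ** matrix_inv (diag_of_mat Q)) *v (s - z)"
    and "i \<in> UNIV - U"
  shows "1 \<bullet> ((fixed_fundamental_matrix E w (U \<union> {i}) - fixed_fundamental_matrix E w U) *v s)
           = g $ i / Q $ i $ i * (s $ i - z $ i) \<and>
         1 \<bullet> ((fixed_fundamental_matrix E w (U \<union> {i}) - fixed_fundamental_matrix E w U) *v s)
           = b $ i"
proof -
  define A where "A = zero_rows U (adjacency_matrix E w)"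
  have Q: "Q = fundamental_matrix A"
    by (simp add: A_def assms(5) fixed_fundamental_matrix_def)
  \<comment> \<open>Fixing nodes can be done one at a time, which reduces the claim to zeroing a
    single row of \<open>A\<close>.\<close>
  have "zero_rows (U \<union> {i}) (adjacency_matrix E w) = zero_rows {i} A"
    by (simp add: A_def zero_rows_def vec_eq_iff)
  then have "1 \<bullet> ((fixed_fundamental_matrix E w (U \<union> {i}) - fixed_fundamental_matrix E w U) *v s)
      = g $ i / Q $ i $ i * (s $ i - z $ i)"
    using sum_fundamental_matrix_zero_row_diff[of i A s]
    by (simp add: fixed_fundamental_matrix_def A_def[symmetric] Q assms(6,7))
  \<comment> \<open>The product is not distributed over \<open>s - z\<close>, so that the entry
    comes out in factored form.\<close>
  moreover have "b $ i = g $ i / Q $ i $ i * (s $ i - z $ i)"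
    by (simp add: assms(8) Q fundamental_matrix_diag_nonzero diag_of_mat_eq matrix_inv_diag_of_vec
        matrix_vector_mul_assoc[symmetric] diag_of_vec_mult_nth divide_inverse
        del: matrix_vector_mult_diff_distrib)
  ultimately show ?thesis
    by simp
qed

end
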